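(* Let $f:(X,\tau_1,\tau_2)\to(Y,\gamma_1,\gamma_2)$ be a function between bitopological spaces and let $i,j\in\{1,2\}$, $i\neq j$. (1) If $f$ is a $d$-open or a $d$-closed surjection, then $f$ is $(i,j)$-locally closed quotient. (2) If $f$ is $(i,j)$-locally closed quotient and $(X,\tau_1,\tau_2)$ is $(i,j)$-submaximal, then $(Y,\gamma_1,\gamma_2)$ is also $(i,j)$-submaximal.
   Context: A bitopological space is a set with two topologies. A subset $A$ of $(X,\tau_1,\tau_2)$ is $(i,j)$-locally closed if for each $x\in A$ there is $U\in\tau_i$ with $x\in U$ and $U\cap A=U\cap\tau_j\mathrm{cl}\,A$ (equivalently, $A=U\cap F$ with $U\in\tau_i$ and $F$ $\tau_j$-closed). The space is $(i,j)$-submaximal if every subset of it is $(i,j)$-locally closed. A surjection $f:(X,\tau_1,\tau_2)\to(Y,\gamma_1,\gamma_2)$ is $(i,j)$-locally closed quotient if, for each $A\subset Y$, $f^{-1}(A)$ being $(i,j)$-locally closed in $X$ implies that $A$ is $(i,j)$-locally closed in $Y$. $f$ is $d$-open ($d$-closed) if both $f:(X,\tau_1)\to(Y,\gamma_1)$ and $f:(X,\tau_2)\to(Y,\gamma_2)$ are open (closed) maps; continuity is not assumed. *)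

theory Defs
  imports "HOL-Analysis.Analysis"
begin

text \<open>
  The bitopological space written \<open>(X, \<tau>\<^sub>1, \<tau>\<^sub>2)\<close> is given by the carrier \<open>X\<close> and a family \<open>T\<close>
  with \<open>T 1\<close> and \<open>T 2\<close> as its two topologies; values of \<open>T\<close> at other indices are irrelevant.
\<close>

definition bitopological_space :: "'a set \<Rightarrow> (nat \<Rightarrow> 'a topology) \<Rightarrow> bool" where
  "bitopological_space X T \<longleftrightarrow> topspace (T 1) = X \<and> topspace (T 2) = X"

definition locally_closed_bitop ::
    "'a set \<Rightarrow> (nat \<Rightarrow> 'a topology) \<Rightarrow> nat \<Rightarrow> nat \<Rightarrow> 'a set \<Rightarrow> bool" where
  "locally_closed_bitop X T i j A \<longleftrightarrow>
     A \<subseteq> X \<and> (\<forall>x\<in>A. \<exists>U. openin (T i) U \<and> x \<in> U \<and> U \<inter> A = U \<inter> (T j) closure_of A)"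

definition submaximal_bitop ::
    "'a set \<Rightarrow> (nat \<Rightarrow> 'a topology) \<Rightarrow> nat \<Rightarrow> nat \<Rightarrow> bool" where
  "submaximal_bitop X T i j \<longleftrightarrow> (\<forall>A. A \<subseteq> X \<longrightarrow> locally_closed_bitop X T i j A)"

text \<open>
  A map between carriers is a total HOL function considered only on \<open>X\<close>, so the preimage of
  \<open>A\<close> is \<open>f -` A \<inter> X\<close>.
\<close>

definition locally_closed_quotient_map ::
    "'a set \<Rightarrow> (nat \<Rightarrow> 'a topology) \<Rightarrow> 'b set \<Rightarrow> (nat \<Rightarrow> 'b topology) \<Rightarrow>
     nat \<Rightarrow> nat \<Rightarrow> ('a \<Rightarrow> 'b) \<Rightarrow> bool" where
  "locally_closed_quotient_map X T Y G i j f \<longleftrightarrow>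
     f ` X = Y \<and>
     (\<forall>A. A \<subseteq> Y \<longrightarrow> locally_closed_bitop X T i j (f -` A \<inter> X) \<longrightarrow>
          locally_closed_bitop Y G i j A)"

definition d_open_map ::
    "(nat \<Rightarrow> 'a topology) \<Rightarrow> (nat \<Rightarrow> 'b topology) \<Rightarrow> ('a \<Rightarrow> 'b) \<Rightarrow> bool" where
  "d_open_map T G f \<longleftrightarrow> open_map (T 1) (G 1) f \<and> open_map (T 2) (G 2) f"

definition d_closed_map ::
    "(nat \<Rightarrow> 'a topology) \<Rightarrow> (nat \<Rightarrow> 'b topology) \<Rightarrow> ('a \<Rightarrow> 'b) \<Rightarrow> bool" where
  "d_closed_map T G f \<longleftrightarrow> closed_map (T 1) (G 1) f \<and> closed_map (T 2) (G 2) f"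

end

theory Submission imports Defs
begin

text \<open>
  Write \<open>f\<^sup>-\<^sup>1(A) = U \<inter> F\<close> with \<open>U\<close> open in the first and \<open>F\<close> closed in the second topology.
  If \<open>f\<close> is open, then \<open>A = f(U) \<inter> cl A\<close>, because preimages under an open map
  satisfy \<open>f\<^sup>-\<^sup>1(cl A) \<subseteq> cl f\<^sup>-\<^sup>1(A)\<close>. If \<open>f\<close> is closed, then \<open>A = (Y - f(X - U)) \<inter> f(F)\<close>,
  because every fibre over \<open>A\<close> lies in \<open>U\<close>.
\<close>

text \<open>The local witnesses glue: their union is one open set that works at every point of
  \<open>A\<close>, with the closure of \<open>A\<close> as closed factor. Conversely, the closure
  of \<open>U \<inter> F\<close> stays inside \<open>F\<close>, so the same \<open>U\<close> serves
  at each point.\<close>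

lemma locally_closed_bitop_iff:
  assumes "topspace (T i) = X" and "topspace (T j) = X"
  shows "locally_closed_bitop X T i j A \<longleftrightarrow>
    (\<exists>U F. openin (T i) U \<and> closedin (T j) F \<and> A = U \<inter> F)" (is "?L \<longleftrightarrow> ?R")
proof
  assume L: ?L
  then have AX: "A \<subseteq> X"
    and loc: "\<forall>x\<in>A. \<exists>U. openin (T i) U \<and> x \<in> U \<and> U \<inter> A = U \<inter> (T j) closure_of A"
    by (auto simp: locally_closed_bitop_def)
  \<comment> \<open>Collecting every open set that satisfies the equation avoids choosing one per
    point; the equation passes to the union.\<close>
  define \<U> where "\<U> = {U. openin (T i) U \<and> U \<inter> A = U \<inter> (T j) closure_of A}"
  have "openin (T i) (\<Union>\<U>)"
    by (auto simp: \<U>_def)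
  moreover have "A = \<Union>\<U> \<inter> (T j) closure_of A"
  proof
    show "A \<subseteq> \<Union>\<U> \<inter> (T j) closure_of A"
    proof (rule Int_greatest)
      show "A \<subseteq> \<Union>\<U>"
        using loc unfolding \<U>_def by blast
      show "A \<subseteq> (T j) closure_of A"
        using AX assms(2) by (simp add: closure_of_subset)
    qed
    show "\<Union>\<U> \<inter> (T j) closure_of A \<subseteq> A"
      unfolding \<U>_def by blast
  qed
  ultimately show ?R
    by (metis closedin_closure_of)
next
  assume ?R
  then obtain U F where U: "openin (T i) U" and F: "closedin (T j) F" and A: "A = U \<inter> F"
    by blast
  have AX: "A \<subseteq> X"
    using A openin_subset[OF U] assms(1) by blast
  have "(T j) closure_of A \<subseteq> F"
    using closure_of_minimal[OF _ F] A by blast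
  moreover have "A \<subseteq> (T j) closure_of A"
    using closure_of_subset AX assms(2) by metis
  ultimately have "U \<inter> A = U \<inter> (T j) closure_of A"
    using A by blast
  with U A AX show ?L
    unfolding locally_closed_bitop_def by blast
qed

text \<open>The image of an open neighbourhood \<open>W\<close> of \<open>x\<close> is an open
  neighbourhood of \<open>f x\<close>, hence meets \<open>A\<close>; a point of \<open>W\<close>
  over the intersection lies in the preimage.\<close>

lemma open_map_vimage_closure_of:
  assumes "open_map S R f"
  shows "f -` (R closure_of A) \<inter> topspace S \<subseteq> S closure_of (f -` A \<inter> topspace S)"
proof
  fix x
  assume x: "x \<in> f -` (R closure_of A) \<inter> topspace S"
  have "\<exists>y \<in> f -` A \<inter> topspace S. y \<in> W" if "x \<in> W" "openin S W" for W
  proof -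
    have "openin R (f ` W)"
      using assms that(2) by (auto simp: open_map_def)
    moreover have "f x \<in> R closure_of A" "f x \<in> f ` W"
      using x that(1) by auto
    ultimately obtain z where "z \<in> A" "z \<in> f ` W"
      unfolding in_closure_of by blast
    then show ?thesis
      using openin_subset[OF that(2)] by blast
  qed
  with x show "x \<in> S closure_of (f -` A \<inter> topspace S)"
    by (auto simp: in_closure_of)
qed

text \<open>An open map need not send \<open>F\<close> to a closed set, so the closure of
  \<open>A\<close> is the closed factor in place of f(F).\<close>

lemma open_map_locally_closed_quotient_map:
  assumes "topspace (T i) = X" "topspace (T j) = X"
    and "topspace (G i) = Y" "topspace (G j) = Y"
    and "open_map (T i) (G i) f" "open_map (T j) (G j) f"
    and surj: "f ` X = Y"
  shows "locally_closed_quotient_map X T Y G i j f"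
  unfolding locally_closed_quotient_map_def
proof (intro conjI allI impI surj)
  fix A
  assume AY: "A \<subseteq> Y" and "locally_closed_bitop X T i j (f -` A \<inter> X)"
  then obtain U F where U: "openin (T i) U" and F: "closedin (T j) F" and B: "f -` A \<inter> X = U \<inter> F"
    using locally_closed_bitop_iff assms(1,2) by metis
  have "(T j) closure_of (f -` A \<inter> X) \<subseteq> F"
    using closure_of_minimal[OF _ F] B by blast
  then have cl: "f -` ((G j) closure_of A) \<inter> X \<subseteq> F"
    using open_map_vimage_closure_of[OF assms(6), of A] assms(2) by auto
  have "A \<subseteq> f ` U"
    using AY surj B by blast
  moreover have "A \<subseteq> (G j) closure_of A"
    using closure_of_subset AY assms(4) by metis
  \<comment> \<open>If u in \<open>U\<close> is mapped into the closure of \<open>A\<close>, then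
    \<open>cl\<close> puts u in \<open>F\<close>, so u lies in \<open>U \<inter> F\<close>, the
    preimage of \<open>A\<close>.\<close>
  moreover have "f ` U \<inter> (G j) closure_of A \<subseteq> A"
    using cl B openin_subset[OF U] assms(1) by blast
  ultimately have "A = f ` U \<inter> (G j) closure_of A"
    by blast
  moreover have "openin (G i) (f ` U)"
    using assms(5) U by (auto simp: open_map_def)
  ultimately show "locally_closed_bitop Y G i j A"
    using locally_closed_bitop_iff assms(3,4) closedin_closure_of by metis
qed

text \<open>Here f(U) need not be open. The open factor consists instead of the points of
  \<open>Y\<close> whose whole fibre in \<open>X\<close> lies in \<open>U\<close>.\<close>

lemma closed_map_locally_closed_quotient_map:
  assumes "topspace (T i) = X" "topspace (T j) = X"
    and "topspace (G i) = Y" "topspace (G j) = Y"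
    and "closed_map (T i) (G i) f" "closed_map (T j) (G j) f"
    and surj: "f ` X = Y"
  shows "locally_closed_quotient_map X T Y G i j f"
  unfolding locally_closed_quotient_map_def
proof (intro conjI allI impI surj)
  fix A
  assume AY: "A \<subseteq> Y" and "locally_closed_bitop X T i j (f -` A \<inter> X)"
  then obtain U F where U: "openin (T i) U" and F: "closedin (T j) F" and B: "f -` A \<inter> X = U \<inter> F"
    using locally_closed_bitop_iff assms(1,2) by metis
  have "closedin (T i) (X - U)"
    using closedin_diff[OF closedin_topspace U] assms(1) by simp
  then have "closedin (G i) (f ` (X - U))"
    using assms(5) by (auto simp: closed_map_def)
  from openin_diff[OF openin_topspace this] have "openin (G i) (Y - f ` (X - U))"
    using assms(3) by simp
  moreover have "closedin (G j) (f ` F)"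
    using assms(6) F by (auto simp: closed_map_def)
  moreover have "A = (Y - f ` (X - U)) \<inter> f ` F"
  proof
    show "A \<subseteq> (Y - f ` (X - U)) \<inter> f ` F"
      using AY B surj by blast
    \<comment> \<open>A point of \<open>F\<close> over such a y cannot lie outside \<open>U\<close>,
      so it lies in the preimage of \<open>A\<close>.\<close>
    show "(Y - f ` (X - U)) \<inter> f ` F \<subseteq> A"
      using B closedin_subset[OF F] assms(2) by blast
  qed
  ultimately show "locally_closed_bitop Y G i j A"
    using locally_closed_bitop_iff assms(3,4) by metis
qed

text \<open>Submaximality of \<open>X\<close> makes the preimage of every subset of \<open>Y\<close>
  locally closed, which is the premise of the quotient property.\<close>

lemma locally_closed_quotient_map_submaximal:
  assumes "locally_closed_quotient_map X T Y G i j f" and "submaximal_bitop X T i j"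
  shows "submaximal_bitop Y G i j"
  using assms by (auto simp: locally_closed_quotient_map_def submaximal_bitop_def)

theorem proposition3p27:
  fixes X :: "'a set" and Y :: "'b set"
    and T :: "nat \<Rightarrow> 'a topology" and G :: "nat \<Rightarrow> 'b topology"
    and f :: "'a \<Rightarrow> 'b" and i j :: nat
  assumes "bitopological_space X T"
    and "bitopological_space Y G"
    and "f \<in> X \<rightarrow> Y"
    and "i \<in> {1, 2}" and "j \<in> {1, 2}" and "i \<noteq> j"
  shows "((d_open_map T G f \<or> d_closed_map T G f) \<and> f ` X = Y \<longrightarrow>
           locally_closed_quotient_map X T Y G i j f) \<and>
         (locally_closed_quotient_map X T Y G i j f \<and> submaximal_bitop X T i j \<longrightarrow>
           submaximal_bitop Y G i j)"
proof -
  have top: "topspace (T i) = X" "topspace (T j) = X" "topspace (G i) = Y" "topspace (G j) = Y"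
    using assms(1,2,4,5) by (auto simp: bitopological_space_def)
  have "locally_closed_quotient_map X T Y G i j f" if "d_open_map T G f" "f ` X = Y"
    using open_map_locally_closed_quotient_map[OF top] that assms(4,5)
    by (auto simp: d_open_map_def)
  moreover have "locally_closed_quotient_map X T Y G i j f" if "d_closed_map T G f" "f ` X = Y"
    using closed_map_locally_closed_quotient_map[OF top] that assms(4,5)
    by (auto simp: d_closed_map_def)
  ultimately show ?thesis
    using locally_closed_quotient_map_submaximal by blast
qed

end
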